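(* Let $S$ be a field. The following are equivalent: (1) $S$ is isomorphic to $\mathbb{F}_2$; (2) for every positive integer $n$, $M_n(S)$ is a $\sqrt{J}$-clean ring; (3) for some positive integer $n$, $M_n(S)$ is a $\sqrt{J}$-clean ring.
   Context: For a ring $R$ (associative with identity $1\neq 0$), $J(R)$ is the Jacobson radical of $R$, and $\sqrt{J(R)}=\{z\in R : z^k\in J(R)\text{ for some } k\ge 1\}$. A ring $R$ is $\sqrt{J}$-clean if every $x\in R$ can be written as $x=e+z$ with $e$ an idempotent of $R$ and $z\in\sqrt{J(R)}$. $M_n(S)$ is the ring of all $n\times n$ matrices over $S$, and $\mathbb{F}_2$ is the field with two elements. *)

theory Defs
  imports
    "Jordan_Normal_Form.Matrix"
    "Jordan_Normal_Form.VS_Connect"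
    "HOL-Algebra.QuotRing"
    "HOL-Library.Z2"
begin

(* The locale ideal of HOL-Algebra is two-sided; over a noncommutative ring the Jacobson
   radical is defined through one-sided maximal ideals. *)

locale left_ideal = additive_subgroup I R + ring R for I and R (structure) +
  assumes l_closed: "\<lbrakk>a \<in> I; x \<in> carrier R\<rbrakk> \<Longrightarrow> x \<otimes> a \<in> I"

locale maximal_left_ideal = left_ideal +
  assumes notcarr: "carrier R \<noteq> I"
    and maximal: "\<lbrakk>left_ideal J R; I \<subseteq> J; J \<subseteq> carrier R\<rbrakk> \<Longrightarrow> J = I \<or> J = carrier R"

(* The intersection with the carrier only matters for the zero ring, which has no maximal
   left ideal. *)
definition jacobson_radical :: "('a, 'b) ring_scheme \<Rightarrow> 'a set" where
  "jacobson_radical R = carrier R \<inter> \<Inter>{I. maximal_left_ideal I R}"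

definition sqrt_jacobson_radical :: "('a, 'b) ring_scheme \<Rightarrow> 'a set" where
  "sqrt_jacobson_radical R =
     {z \<in> carrier R. \<exists>k::nat. k \<ge> 1 \<and> z [^]\<^bsub>R\<^esub> k \<in> jacobson_radical R}"

locale sqrtJ_clean_ring = ring R for R (structure) +
  assumes one_not_zero: "\<one> \<noteq> \<zero>"
    and clean: "x \<in> carrier R \<Longrightarrow>
      \<exists>e z. e \<in> carrier R \<and> e \<otimes> e = e \<and> z \<in> sqrt_jacobson_radical R \<and> x = e \<oplus> z"

end

theory Submission
  imports Defs "HOL-Library.Function_Algebras"
begin

text \<open>
The Jacobson radical of a matrix ring over a field vanishes, because the matrices whose
\<open>j\<close>-th column is zero form a maximal left ideal for every \<open>j\<close>
(\<open>column_maximal_left_ideal\<close>). So the condition on the matrix ring says that every matrix is the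
sum of an idempotent and a nilpotent one.

If a scalar matrix \<open>c\<close> is such a sum \<open>E + Z\<close>, then \<open>E Z\<^sup>k = (c - 1)\<^sup>k E\<close>, so that \<open>c = 1\<close> or
\<open>E = 0\<close>, and in the latter case the scalar \<open>c\<close> is nilpotent, hence zero. Therefore a single
dimension \<open>n > 0\<close> already forces the field to consist of 0 and 1
(\<open>mat_sqrtJ_clean_two_elements\<close>).

Conversely, let the field have two elements and let \<open>f\<close> be an endomorphism of a finite-dimensional
space. If \<open>W\<close> is an invariant subspace and \<open>v\<close> a further vector, then adding
\<open>u\<^sub>i = f\<^sup>i v\<close> for \<open>i < m\<close>, where \<open>m\<close> is minimal such that \<open>u\<^sub>m\<close> depends on \<open>W\<close> and its
predecessors, yields a larger invariant subspace. A decomposition on \<open>W\<close> extends to it: the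
matrix of \<open>f\<close> becomes block triangular with a companion matrix as the new diagonal block, so it is
enough to split companion matrices. Write \<open>u\<^sub>m = w + low + u\<^sub>k\<close> with \<open>w\<close> in \<open>W\<close> and \<open>low\<close> a
combination of the \<open>u\<^sub>i\<close> with \<open>i < k\<close>. The idempotent that kills \<open>u\<^sub>i\<close> for \<open>i < k\<close>, maps
\<open>u\<^sub>i\<close> to \<open>u\<^sub>k\<close> for \<open>k \<le> i < m - 1\<close>, and maps \<open>u\<^sub>m\<^sub>-\<^sub>1\<close> to \<open>u\<^sub>m\<^sub>-\<^sub>1 + low\<close> leaves a remainder that is
nilpotent modulo \<open>W\<close> (\<open>krylov_nil_clean_splitting\<close>). If \<open>u\<^sub>m\<close> lies in \<open>W\<close>, the idempotent 0 does.
This replaces the rational canonical form: only a flag of invariant subspaces with cyclic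
quotients is used, not a direct sum of cyclic subspaces.
\<close>

section \<open>Linear maps prescribed on a sequence of new vectors\<close>

context vector_space
begin

lemma linear_extend_one:
  assumes g: "Vector_Spaces.linear scale scale g" and v: "v \<notin> span S"
  shows "\<exists>g'. Vector_Spaces.linear scale scale g' \<and> (\<forall>x\<in>span S. g' x = g x) \<and> g' v = t"
proof -
  interpret p: vector_space_pair scale scale by unfold_locales
  obtain B where B: "B \<subseteq> S" "independent B" "S \<subseteq> span B"
    using maximal_independent_subset[of S] by blast
  have sp: "span B = span S"
    using B(1,3) span_minimal[OF B(3)] span_mono[OF B(1)] by auto
  have "independent (insert v B)"
    using B(2) v sp by (intro independent_insertI) auto
  then obtain g' where g': "Vector_Spaces.linear scale scale g'" "\<forall>x\<in>insert v B. g' x = (g(v := t)) x"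
    using p.linear_independent_extend by blast
  have "v \<notin> B" using v sp span_base by auto
  then have "g' b = g b" if "b \<in> B" for b using g'(2) that by auto
  then have "g' x = g x" if "x \<in> span S" for x
    using p.linear_eq_on[OF g'(1) g] that sp by auto
  then show ?thesis using g' by auto
qed

text \<open>
Independence of the \<open>v i\<close> over \<open>W\<close> is expressed by each one avoiding the span of what came
before, which is the form in which it arises for the orbit of a vector.
\<close>
lemma linear_extend_sequence:
  fixes v :: "nat \<Rightarrow> 'b"
  assumes g: "Vector_Spaces.linear scale scale g"
    and v: "\<And>i. i < m \<Longrightarrow> v i \<notin> span (W \<union> v ` {..<i})"
  shows "\<exists>g'. Vector_Spaces.linear scale scale g' \<and> (\<forall>x\<in>W. g' x = g x) \<and> (\<forall>i<m. g' (v i) = t i)"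
  using v
proof (induction m)
  case 0
  then show ?case using g by auto
next
  case (Suc m)
  then obtain g1 where g1: "Vector_Spaces.linear scale scale g1" "\<forall>x\<in>W. g1 x = g x" "\<forall>i<m. g1 (v i) = t i"
    by (metis less_Suc_eq)
  obtain g' where g': "Vector_Spaces.linear scale scale g'" "\<forall>x\<in>span (W \<union> v ` {..<m}). g' x = g1 x"
    "g' (v m) = t m"
    using linear_extend_one[OF g1(1), of "v m"] Suc.prems[of m] by blast
  have "g' x = g x" if "x \<in> W" for x
    using that g'(2) g1(2) by (auto simp: span_base)
  moreover have "g' (v i) = t i" if "i < Suc m" for i
    using that g'(2,3) g1(3) by (cases "i = m") (auto simp: span_base)
  ultimately show ?case using g'(1) by blast
qed

lemma span_sequence_sum:
  fixes v :: "nat \<Rightarrow> 'b"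
  assumes "x \<in> span (W \<union> v ` {..<m})" "subspace W"
  shows "\<exists>w\<in>W. \<exists>c. x = w + (\<Sum>i<m. c i *s v i)"
  using assms(1)
proof (induction m arbitrary: x)
  case 0
  then show ?case using span_eq_iff[THEN iffD2, OF assms(2)] by auto
next
  case (Suc m)
  have "x \<in> span (insert (v m) (W \<union> v ` {..<m}))"
    using Suc.prems by (simp add: lessThan_Suc)
  then obtain a where "x - a *s v m \<in> span (W \<union> v ` {..<m})"
    unfolding span_breakdown_eq by blast
  from Suc.IH[OF this] obtain w c where
    wc: "w \<in> W" "x - a *s v m = w + (\<Sum>i<m. c i *s v i)" by blast
  have "x = w + (\<Sum>i<Suc m. (c(m := a)) i *s v i)"
    using wc(2) by (simp add: algebra_simps)
  then show ?case using wc(1) by blast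
qed

text \<open>
Otherwise the sequence would contain arbitrarily many independent vectors in a space spanned by
finitely many.
\<close>
lemma sequence_hits_span:
  fixes v :: "nat \<Rightarrow> 'b"
  assumes T: "finite T" and v: "\<And>i. v i \<in> span T"
  shows "\<exists>m. v m \<in> span (W \<union> v ` {..<m}) \<and> (\<forall>i<m. v i \<notin> span (W \<union> v ` {..<i}))"
proof -
  have "\<exists>m. v m \<in> span (W \<union> v ` {..<m})"
  proof (rule ccontr)
    assume "\<not> ?thesis"
    then have new: "v m \<notin> span (v ` {..<m})" for m
      by (meson span_mono subsetD sup_ge2)
    have "independent (v ` {..<m}) \<and> card (v ` {..<m}) = m" for m
    proof (induction m)
      case (Suc m)
      have "v m \<notin> v ` {..<m}" using new[of m] by (auto intro: span_base)
      then show ?case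
        using Suc new[of m] by (simp add: lessThan_Suc independent_insertI)
    qed (simp add: independent_empty)
    from this[of "Suc (card T)"] show False
      using independent_span_bound[OF T, of "v ` {..<Suc (card T)}"] v by auto
  qed
  then show ?thesis
    using exists_least_iff[of "\<lambda>m. v m \<in> span (W \<union> v ` {..<m})"] by simp
qed

end

section \<open>Splittings into an idempotent and a nilpotent map\<close>

lemma funpow_commute: "(g ^^ m) ((g ^^ n) x) = (g ^^ n) ((g ^^ m) x)"
proof -
  have "(g ^^ m \<circ> g ^^ n) x = (g ^^ n \<circ> g ^^ m) x"
    by (simp only: funpow_add[symmetric] add.commute)
  then show ?thesis by simp
qed

text \<open>
The relation is stated for total maps but constrains them only on \<open>W\<close>, so that \<open>e\<close> can be enlarged
step by step while \<open>W\<close> grows and \<open>f\<close> stays the same. The nilpotent summand is \<open>f - e\<close>; it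
preserves \<open>W\<close> as soon as \<open>f\<close> does.
\<close>
definition nil_clean_splitting :: "('b::ab_group_add \<Rightarrow> 'b) \<Rightarrow> ('b \<Rightarrow> 'b) \<Rightarrow> 'b set \<Rightarrow> bool" where
  "nil_clean_splitting f e W \<longleftrightarrow>
     (\<forall>x\<in>W. e x \<in> W) \<and> (\<forall>x\<in>W. e (e x) = e x) \<and>
     (\<exists>N. \<forall>x\<in>W. ((\<lambda>x. f x - e x) ^^ N) x = 0)"

context vector_space
begin

lemma linear_funpow:
  "Vector_Spaces.linear scale scale g \<Longrightarrow> Vector_Spaces.linear scale scale (g ^^ n)"
proof (induction n)
  case 0
  then show ?case by (simp add: linear_id id_def[symmetric])
next
  case (Suc n)
  then show ?case using Vector_Spaces.linear_compose[of scale scale "g ^^ n" scale g] by (simp add: comp_def)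
qed

lemma funpow_closed: "x \<in> W \<Longrightarrow> (\<And>x. x \<in> W \<Longrightarrow> g x \<in> W) \<Longrightarrow> (g ^^ n) x \<in> W"
  by (induction n) auto

lemma linear_closed_span:
  assumes g: "Vector_Spaces.linear scale scale g" and S: "\<And>s. s \<in> S \<Longrightarrow> g s \<in> U" and U: "subspace U"
    and x: "x \<in> span S"
  shows "g x \<in> U"
proof -
  interpret g: Vector_Spaces.linear scale scale g by fact
  have "span S \<subseteq> g -` U"
    using S by (intro span_minimal g.subspace_vimage U) auto
  then show ?thesis using x by auto
qed

text \<open>
In a block triangular situation the idempotent on the new block may be chosen independently of the
old one, provided that it is idempotent exactly and not only modulo \<open>W\<close>. The nilpotent part has to
be nilpotent only modulo \<open>W\<close>: after \<open>M\<close> steps it has moved everything into \<open>W\<close>, where the given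
splitting takes over.
\<close>
lemma nil_clean_splitting_extend:
  assumes f: "Vector_Spaces.linear scale scale f" and W: "subspace W" "\<And>x. x \<in> W \<Longrightarrow> f x \<in> W"
    and e0: "nil_clean_splitting f e0 W"
    and e: "Vector_Spaces.linear scale scale e" "\<And>x. x \<in> W \<Longrightarrow> e x = e0 x"
    and X: "\<And>x. x \<in> X \<Longrightarrow> e x \<in> span (W \<union> X)" "\<And>x. x \<in> X \<Longrightarrow> e (e x) = e x"
    and nil: "\<And>x. x \<in> X \<Longrightarrow> ((\<lambda>x. f x - e x) ^^ M) x \<in> W"
  shows "nil_clean_splitting f e (span (W \<union> X))"
proof -
  interpret p: vector_space_pair scale scale by unfold_locales
  define z where "z = (\<lambda>x. f x - e x)"
  define z0 where "z0 = (\<lambda>x. f x - e0 x)"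
  have lin_z: "Vector_Spaces.linear scale scale z"
    unfolding z_def using f e(1) by (rule p.linear_compose_sub)
  have e0W: "e0 x \<in> W" "e0 (e0 x) = e0 x" if "x \<in> W" for x
    using e0 that unfolding nil_clean_splitting_def by auto
  obtain N where N: "\<And>x. x \<in> W \<Longrightarrow> (z0 ^^ N) x = 0"
    using e0 unfolding nil_clean_splitting_def z0_def by blast
  have zW: "z x = z0 x" "z0 x \<in> W" if "x \<in> W" for x
    using that e(2) e0W W subspace_diff[OF W(1)] unfolding z_def z0_def by auto
  have z_pow: "(z ^^ n) x = (z0 ^^ n) x" if "x \<in> W" for n x
  proof (induction n)
    case (Suc n)
    have "(z0 ^^ n) x \<in> W" using that zW(2) by (rule funpow_closed)
    then show ?case using Suc zW(1) by simp
  qed simp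
  have "e x \<in> span (W \<union> X)" if "x \<in> span (W \<union> X)" for x
    using e(1) _ subspace_span that
    by (rule linear_closed_span) (use X e e0W in \<open>auto simp: span_base\<close>)
  moreover have "e (e x) = e x" if "x \<in> span (W \<union> X)" for x
  proof (rule p.linear_eq_on[OF _ e(1) that])
    show "Vector_Spaces.linear scale scale (\<lambda>x. e (e x))"
      using Vector_Spaces.linear_compose[OF e(1) e(1)] by (simp add: comp_def)
  qed (use X e(2) e0W in auto)
  moreover have "(z ^^ (N + M)) x = 0" if "x \<in> span (W \<union> X)" for x
  proof -
    have "(z ^^ M) x \<in> W"
      using linear_funpow[OF lin_z] _ W(1) that
    proof (rule linear_closed_span)
      fix s assume "s \<in> W \<union> X"
      then show "(z ^^ M) s \<in> W"
        using nil[of s] zW funpow_closed[of s W z] unfolding z_def[symmetric] by auto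
    qed
    then show ?thesis using N z_pow by (simp add: funpow_add)
  qed
  ultimately show ?thesis
    using e(1) unfolding nil_clean_splitting_def z_def by blast
qed

text \<open>
This is the splitting of a companion matrix over the field with two elements, relative to \<open>W\<close>.
The trace of a nilpotent matrix is zero, so the rank of the idempotent must have the parity of the
trace: it is 0 if \<open>f\<close> is nilpotent modulo \<open>W\<close>, it is 1 if \<open>k = m - 1\<close>, and it is 2 in the
remaining case, where the image of \<open>e\<close> is spanned by \<open>u k\<close> and \<open>u (m - 1) + low\<close>.
\<close>
lemma krylov_nil_clean_splitting:
  fixes f :: "'b \<Rightarrow> 'b" and v :: 'b
  defines "u \<equiv> \<lambda>i. (f ^^ i) v"
  assumes two: "\<And>c::'a. c = 0 \<or> c = 1"
    and f: "Vector_Spaces.linear scale scale f" and W: "subspace W" "\<And>x. x \<in> W \<Longrightarrow> f x \<in> W"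
    and lin_e0: "Vector_Spaces.linear scale scale e0" and e0: "nil_clean_splitting f e0 W"
    and new: "\<And>i. i < m \<Longrightarrow> u i \<notin> span (W \<union> u ` {..<i})"
    and dep: "u m \<in> span (W \<union> u ` {..<m})"
  shows "\<exists>e. Vector_Spaces.linear scale scale e \<and> nil_clean_splitting f e (span (W \<union> u ` {..<m}))"
proof -
  interpret p: vector_space_pair scale scale by unfold_locales
  have e0W: "\<And>x. x \<in> W \<Longrightarrow> e0 x \<in> W"
    using e0 unfolding nil_clean_splitting_def by auto
  have u_Suc: "f (u i) = u (Suc i)" for i by (simp add: u_def)
  have "(1::'a) + 1 = 0"
    using two[of "1 + 1"] by (metis add_cancel_right_right zero_neq_one)
  then have char2: "x + x = 0" for x :: 'b
    using scale_left_distrib[of 1 1 x] by simp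
  obtain w c where w: "w \<in> W" and um: "u m = w + (\<Sum>i<m. c i *s u i)"
    using span_sequence_sum[OF dep W(1)] by blast
  have zW: "f x - e x \<in> W" if "\<And>x. x \<in> W \<Longrightarrow> e x = e0 x" "x \<in> W" for e x
    using that W e0W by (auto intro: subspace_diff)
  show ?thesis
  proof (cases "\<forall>i<m. c i = 0")
    case True
    then have uW: "u m \<in> W" using w um by simp
    obtain e where e: "Vector_Spaces.linear scale scale e" "\<And>x. x \<in> W \<Longrightarrow> e x = e0 x"
      "\<And>i. i < m \<Longrightarrow> e (u i) = 0"
      using linear_extend_sequence[where v = u and t = "\<lambda>_. 0", OF lin_e0 new] by blast
    interpret e: Vector_Spaces.linear scale scale e by fact
    define z where "z = (\<lambda>x. f x - e x)"
    have z_pow: "(z ^^ i) (u 0) = u i" if "i \<le> m" for i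
      using that by (induction i) (auto simp: z_def e u_Suc)
    have "(z ^^ m) (u i) \<in> W" if "i < m" for i
    proof -
      have "(z ^^ m) (u i) = (z ^^ i) (u m)"
        using z_pow[of i] z_pow[of m] that funpow_commute[of m z i "u 0"] by simp
      then show ?thesis
        using zW[OF e(2)] uW unfolding z_def by (auto intro!: funpow_closed)
    qed
    then have "nil_clean_splitting f e (span (W \<union> u ` {..<m}))"
      using e e.zero unfolding z_def
      by (intro nil_clean_splitting_extend[OF f W e0 e(1,2)]) (auto simp: span_zero)
    then show ?thesis using e(1) by blast
  next
    case False
    \<comment> \<open>the last coefficient that is nonzero, hence 1\<close>
    define k where "k = Max {i. i < m \<and> c i \<noteq> 0}"
    have "k \<in> {i. i < m \<and> c i \<noteq> 0}"
      unfolding k_def using False by (intro Max_in) auto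
    then have k: "k < m" "c k = 1" using two by auto
    have above: "c i = 0" if "k < i" "i < m" for i
      using that Max_ge[of "{i. i < m \<and> c i \<noteq> 0}" i] unfolding k_def by fastforce
    define low where "low = (\<Sum>i<k. c i *s u i)"
    have "(\<Sum>i<m. c i *s u i) = (\<Sum>i<Suc k. c i *s u i)"
      using k above by (intro sum.mono_neutral_right) auto
    then have um: "u m = w + low + u k"
      using um k by (simp add: low_def add.assoc)
    define n where "n = m - 1"
    have n: "m = Suc n" "k \<le> n" using k by (auto simp: n_def)
    define t where "t = (\<lambda>i. if i < k then 0 else if i < n then u k else u n + low)"
    obtain e where e: "Vector_Spaces.linear scale scale e" "\<And>x. x \<in> W \<Longrightarrow> e x = e0 x"
      "\<And>i. i < m \<Longrightarrow> e (u i) = t i"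
      using linear_extend_sequence[where v = u and t = t, OF lin_e0 new] by blast
    interpret e: Vector_Spaces.linear scale scale e by fact
    have e_low: "e low = 0"
      using k by (simp add: low_def e.sum e.scale e t_def)
    have e_n: "e (u n) = u n + low" "e (u n + low) = u n + low"
      using n e(3)[of n] by (auto simp: t_def e_low e.add)
    have e_k: "e (t i) = t i" if "i < m" for i
      using that n e(3)[of k] e_n(2) by (auto simp: t_def e.zero)
    have low_span: "low \<in> span (u ` {..<m})"
      unfolding low_def using k by (intro span_sum span_scale span_base) auto
    have "t i \<in> span (u ` {..<m})" for i
      using n low_span k unfolding t_def by (auto intro!: span_add span_zero intro: span_base)
    then have t_span: "t i \<in> span (W \<union> u ` {..<m})" for i
      using span_mono[of "u ` {..<m}" "W \<union> u ` {..<m}"] by auto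
    define z where "z = (\<lambda>x. f x - e x)"
    have lin_z: "Vector_Spaces.linear scale scale z"
      unfolding z_def using f e(1) by (rule p.linear_compose_sub)
    interpret z: Vector_Spaces.linear scale scale z by fact
    \<comment> \<open>Up to \<open>k\<close> the map \<open>z\<close> shifts the sequence; from then on it shifts the differences
      \<open>u (i + 1) - u i\<close>, starting with \<open>z (u k) = u (k + 1) - u k\<close>.\<close>
    have z_below: "z (u i) = u (Suc i)" if "i < k" for i
      using that k by (simp add: z_def e u_Suc t_def)
    have z_mid: "z (u i) = u (Suc i) - u k" if "k \<le> i" "i < n" for i
      using that n by (simp add: z_def e u_Suc t_def)
    have z_last: "z (u n) = w + u k - u n"
      using n um by (simp add: z_def e_n u_Suc)
    have z_W: "(z ^^ j) x \<in> W" if "x \<in> W" for j x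
      using that zW[OF e(2)] unfolding z_def by (auto intro: funpow_closed)
    have pow_0: "(z ^^ i) (u 0) = u i" if "i \<le> k" for i
      using that by (induction i) (auto simp: z_below)
    have pow_k: "(z ^^ Suc j) (u k) = u (k + Suc j) - u (k + j)" if "k + j < n" for j
      using that by (induction j) (auto simp: z_mid z.diff)
    have "(z ^^ (m - k)) (u k) \<in> W"
    proof (cases "k = n")
      case True
      then show ?thesis using n z_last w by simp
    next
      case False
      define j where "j = n - Suc k"
      have j: "n = k + Suc j" using False n by (simp add: j_def)
      \<comment> \<open>The last difference is mapped into \<open>W\<close>, because the characteristic is 2.\<close>
      have "(z ^^ (m - k)) (u k) = z (u n - u (k + j))"
        using pow_k[of j] j n by simp
      also have "\<dots> = w + ((u k + u k) - (u n + u n))"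
        using j z_mid[of "k + j"] z_last by (simp add: z.diff)
      finally show ?thesis using w by (simp add: char2)
    qed
    moreover have "(z ^^ m) (u 0) = (z ^^ (m - k)) (u k)"
      using pow_0[of k] k funpow_add[of "m - k" k z] by simp
    ultimately have pow_m_0: "(z ^^ m) (u 0) \<in> W" by simp
    \<comment> \<open>The orbit of \<open>u 0\<close> under \<open>z\<close> generates all \<open>u i\<close>, so the conclusion for \<open>u 0\<close> spreads.\<close>
    have below: "(z ^^ m) (u i) \<in> W" if "i \<le> k" for i
      using z_W[OF pow_m_0, of i] funpow_commute[of m z i "u 0"] pow_0[OF that] by simp
    have "(z ^^ m) (u (k + j)) \<in> W" if "k + j < m" for j
      using that
    proof (induction j)
      case 0
      then show ?case using below by simp
    next
      case (Suc j)
      interpret zm: Vector_Spaces.linear scale scale "z ^^ m" using lin_z by (rule linear_funpow)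
      have "u (k + Suc j) = (z ^^ Suc j) (u k) + u (k + j)"
        using pow_k[of j] Suc.prems n by simp
      then have "(z ^^ m) (u (k + Suc j)) = (z ^^ Suc j) ((z ^^ m) (u k)) + (z ^^ m) (u (k + j))"
        by (simp only: zm.add funpow_commute[of m z "Suc j"])
      then show ?case
        using z_W[OF below[of k], of "Suc j"] Suc W(1) by (auto intro: subspace_add)
    qed
    then have "(z ^^ m) (u i) \<in> W" if "i < m" for i
      using below that by (metis le_add_diff_inverse nat_le_linear)
    then have "nil_clean_splitting f e (span (W \<union> u ` {..<m}))"
      using e e_k t_span unfolding z_def
      by (intro nil_clean_splitting_extend[OF f W e0 e(1,2)]) auto
    then show ?thesis using e(1) by blast
  qed
qed

text \<open>
Starting from the zero space, the generators in \<open>T\<close> are absorbed one after the other by adding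
their whole orbits under \<open>f\<close>, which keeps the subspace invariant.
\<close>
theorem ex_nil_clean_splitting:
  assumes two: "\<And>c::'a. c = 0 \<or> c = 1"
    and f: "Vector_Spaces.linear scale scale f"
    and T: "finite T" and inv: "\<And>x. x \<in> span T \<Longrightarrow> f x \<in> span T"
  shows "\<exists>e. Vector_Spaces.linear scale scale e \<and> nil_clean_splitting f e (span T)"
proof -
  have "\<exists>W e. subspace W \<and> (\<forall>x\<in>W. f x \<in> W) \<and> A \<subseteq> W \<and> W \<subseteq> span T \<and>
      Vector_Spaces.linear scale scale e \<and> nil_clean_splitting f e W"
    if "finite A" "A \<subseteq> span T" for A
    using that
  proof (induction A)
    case empty
    interpret f: Vector_Spaces.linear scale scale f by fact
    have "nil_clean_splitting f (\<lambda>x. x) {0}"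
      unfolding nil_clean_splitting_def by (auto intro!: exI[of _ 1])
    then show ?case
      by (intro exI[of _ "{0}"] exI[of _ "\<lambda>x. x"]) (auto simp: span_zero linear_ident)
  next
    case (insert v A)
    then obtain W e0 where W: "subspace W" "\<And>x. x \<in> W \<Longrightarrow> f x \<in> W" "A \<subseteq> W" "W \<subseteq> span T"
      and lin_e0: "Vector_Spaces.linear scale scale e0" and e0: "nil_clean_splitting f e0 W" by auto
    define u where "u = (\<lambda>i. (f ^^ i) v)"
    have u: "u i \<in> span T" for i
      unfolding u_def using insert.prems inv by (intro funpow_closed) auto
    obtain m where dep: "u m \<in> span (W \<union> u ` {..<m})"
      and new: "\<And>i. i < m \<Longrightarrow> u i \<notin> span (W \<union> u ` {..<i})"
      using sequence_hits_span[of T u W, OF T u] by auto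
    let ?W = "span (W \<union> u ` {..<m})"
    obtain e where lin_e: "Vector_Spaces.linear scale scale e" and e: "nil_clean_splitting f e ?W"
      using krylov_nil_clean_splitting[OF two f W(1,2) lin_e0 e0 new[unfolded u_def] dep[unfolded u_def]]
      unfolding u_def by blast
    have u_in: "u i \<in> ?W" if "i \<le> m" for i
      using that dep by (cases "i = m") (auto simp: span_base)
    have "f x \<in> ?W" if "x \<in> ?W" for x
      using f _ subspace_span that
    proof (rule linear_closed_span)
      fix s assume "s \<in> W \<union> u ` {..<m}"
      then show "f s \<in> ?W"
        using W(2) u_in[of "Suc _"] by (auto simp: span_base u_def)
    qed
    moreover have "v \<in> ?W" using u_in[of 0] by (simp add: u_def)
    moreover have "A \<subseteq> ?W" using W(3) by (auto simp: span_base)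
    moreover have "?W \<subseteq> span T" using W(4) u by (intro span_minimal) auto
    ultimately show ?case using lin_e e by (intro exI[of _ ?W] exI[of _ e]) auto
  qed
  from this[OF T] obtain W e where W: "subspace W" "T \<subseteq> W" "W \<subseteq> span T"
    and e: "Vector_Spaces.linear scale scale e" "nil_clean_splitting f e W" by (auto simp: span_superset)
  moreover have "W = span T" using W span_minimal by blast
  ultimately show ?thesis by auto
qed

end

section \<open>Matrices over the field with two elements\<close>

text \<open>
The space of column vectors of length \<open>n\<close> is taken to be the space of functions on the naturals
that vanish from \<open>n\<close> on: it lies in a type that does not depend on \<open>n\<close>, which makes the linear
algebra of spans and linear maps applicable for every \<open>n\<close>.
\<close>
definition fun_scale :: "'a::field \<Rightarrow> (nat \<Rightarrow> 'a) \<Rightarrow> nat \<Rightarrow> 'a" where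
  "fun_scale c x = (\<lambda>i. c * x i)"

interpretation fun_space: vector_space fun_scale
  by unfold_locales (auto simp: fun_scale_def fun_eq_iff algebra_simps)

definition unit_fun :: "nat \<Rightarrow> nat \<Rightarrow> 'a::field" where
  "unit_fun j = (\<lambda>i. if i = j then 1 else 0)"

abbreviation coord_space :: "nat \<Rightarrow> (nat \<Rightarrow> 'a::field) set" where
  "coord_space n \<equiv> fun_space.span (unit_fun ` {..<n})"

definition mat_of_map :: "nat \<Rightarrow> ((nat \<Rightarrow> 'a) \<Rightarrow> nat \<Rightarrow> 'a) \<Rightarrow> 'a::field mat" where
  "mat_of_map n g = mat n n (\<lambda>(i, j). g (unit_fun j) i)"

lemma sum_fun_apply: "sum f A i = (\<Sum>a\<in>A. f a i)"
  for f :: "'b \<Rightarrow> nat \<Rightarrow> 'a::comm_monoid_add"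
  by (induction A rule: infinite_finite_induct) auto

lemma sum_unit_fun:
  fixes x :: "nat \<Rightarrow> 'a::field"
  assumes x: "\<And>i. i \<ge> n \<Longrightarrow> x i = 0"
  shows "x = (\<Sum>j<n. fun_scale (x j) (unit_fun j))"
proof
  fix i
  show "x i = (\<Sum>j<n. fun_scale (x j) (unit_fun j)) i"
    using x[of i] unfolding sum_fun_apply fun_scale_def unit_fun_def
    by (simp add: if_distrib cong: if_cong)
qed

lemma linear_fun_apply:
  fixes x :: "nat \<Rightarrow> 'a::field"
  assumes g: "Vector_Spaces.linear fun_scale fun_scale g" and x: "\<And>i. i \<ge> n \<Longrightarrow> x i = 0"
  shows "g x i = (\<Sum>j<n. x j * g (unit_fun j) i)"
proof -
  interpret g: Vector_Spaces.linear fun_scale fun_scale g by fact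
  have "g x = g (\<Sum>j<n. fun_scale (x j) (unit_fun j))"
    by (rule arg_cong[OF sum_unit_fun[OF x]])
  then have "g x = (\<Sum>j<n. fun_scale (x j) (g (unit_fun j)))"
    by (simp add: g.sum g.scale)
  then show ?thesis
    by (simp add: sum_fun_apply fun_scale_def)
qed

lemma coord_space_iff: "x \<in> coord_space n \<longleftrightarrow> (\<forall>i\<ge>n. x i = 0)"
proof
  have "coord_space n \<subseteq> {x. \<forall>i\<ge>n. x i = 0}"
    by (rule fun_space.span_minimal)
      (auto simp: fun_space.subspace_def fun_scale_def unit_fun_def)
  then show "x \<in> coord_space n \<Longrightarrow> \<forall>i\<ge>n. x i = 0" by blast
next
  assume "\<forall>i\<ge>n. x i = 0"
  then have "x = (\<Sum>j<n. fun_scale (x j) (unit_fun j))"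
    by (intro sum_unit_fun) blast
  also have "\<dots> \<in> coord_space n"
    by (intro fun_space.span_sum fun_space.span_scale fun_space.span_base) auto
  finally show "x \<in> coord_space n" .
qed

lemma mat_of_map_carrier [simp]: "mat_of_map n g \<in> carrier_mat n n"
  by (simp add: mat_of_map_def)

lemma mat_of_map_comp:
  assumes g: "Vector_Spaces.linear fun_scale fun_scale g"
    and h: "\<And>x. x \<in> coord_space n \<Longrightarrow> h x \<in> coord_space n"
  shows "mat_of_map n (\<lambda>x. g (h x)) = mat_of_map n g * mat_of_map n h"
proof (rule eq_matI)
  fix i j
  assume "i < dim_row (mat_of_map n g * mat_of_map n h)"
    and "j < dim_col (mat_of_map n g * mat_of_map n h)"
  then have ij: "i < n" "j < n" by (auto simp: mat_of_map_def)
  have "h (unit_fun j) \<in> coord_space n"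
    using ij by (intro h fun_space.span_base) auto
  then have "g (h (unit_fun j)) i = (\<Sum>l<n. h (unit_fun j) l * g (unit_fun l) i)"
    by (intro linear_fun_apply g) (auto simp: coord_space_iff)
  then show "mat_of_map n (\<lambda>x. g (h x)) $$ (i, j) = (mat_of_map n g * mat_of_map n h) $$ (i, j)"
    using ij by (simp add: mat_of_map_def scalar_prod_def mult.commute lessThan_atLeast0)
qed (auto simp: mat_of_map_def)

lemma mat_of_map_funpow:
  assumes g: "Vector_Spaces.linear fun_scale fun_scale g"
    and inv: "\<And>x. x \<in> coord_space n \<Longrightarrow> g x \<in> coord_space n"
  shows "mat_of_map n (g ^^ k) = mat_of_map n g ^\<^sub>m k"
proof (induction k)
  case 0
  show ?case by (rule eq_matI) (auto simp: mat_of_map_def unit_fun_def)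
next
  case (Suc k)
  have "mat_of_map n (g ^^ Suc k) = mat_of_map n (\<lambda>x. (g ^^ k) (g x))"
    by (simp add: funpow_Suc_right comp_def del: funpow.simps)
  also have "\<dots> = mat_of_map n (g ^^ k) * mat_of_map n g"
    by (intro mat_of_map_comp fun_space.linear_funpow g inv)
  finally show ?case using Suc by (simp del: funpow.simps)
qed

theorem two_element_field_mat_nil_clean:
  fixes A :: "'a::field mat"
  assumes two: "\<And>c::'a. c = 0 \<or> c = 1" and A: "A \<in> carrier_mat n n"
  shows "\<exists>E Z k. E \<in> carrier_mat n n \<and> E * E = E \<and> Z \<in> carrier_mat n n \<and>
    Z ^\<^sub>m k = 0\<^sub>m n n \<and> A = E + Z"
proof -
  define f where "f = (\<lambda>x i. if i < n then \<Sum>j<n. A $$ (i, j) * x j else 0)"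
  have f: "Vector_Spaces.linear fun_scale fun_scale f"
    by unfold_locales
      (auto simp: f_def fun_scale_def fun_eq_iff algebra_simps sum.distrib sum_distrib_left)
  have fV: "f x \<in> coord_space n" for x
    by (simp add: coord_space_iff f_def)
  have Af: "A = mat_of_map n f"
    using A by (intro eq_matI)
      (auto simp: mat_of_map_def f_def unit_fun_def if_distrib cong: if_cong)
  obtain e where e: "Vector_Spaces.linear fun_scale fun_scale e"
    and split: "nil_clean_splitting f e (coord_space n)"
    using fun_space.ex_nil_clean_splitting[OF two f, of "unit_fun ` {..<n}"] fV by blast
  have eV: "e x \<in> coord_space n" and ee: "e (e x) = e x" if "x \<in> coord_space n" for x
    using split that unfolding nil_clean_splitting_def by auto
  define z where "z = (\<lambda>x. f x - e x)"
  obtain N where N: "\<And>x. x \<in> coord_space n \<Longrightarrow> (z ^^ N) x = 0"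
    using split unfolding nil_clean_splitting_def z_def by blast
  interpret p: vector_space_pair fun_scale fun_scale by unfold_locales
  have z: "Vector_Spaces.linear fun_scale fun_scale z"
    unfolding z_def using f e by (rule p.linear_compose_sub)
  have zV: "z x \<in> coord_space n" if "x \<in> coord_space n" for x
    unfolding z_def using fV eV[OF that] by (rule fun_space.span_diff)
  have unit: "unit_fun j \<in> coord_space n" if "j < n" for j
    using that by (auto intro: fun_space.span_base)
  have "mat_of_map n e * mat_of_map n e = mat_of_map n (\<lambda>x. e (e x))"
    using mat_of_map_comp[OF e eV] by simp
  also have "\<dots> = mat_of_map n e"
    by (rule eq_matI) (auto simp: mat_of_map_def ee unit)
  finally have "mat_of_map n e * mat_of_map n e = mat_of_map n e" .
  moreover have "mat_of_map n z ^\<^sub>m N = 0\<^sub>m n n"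
  proof -
    have "mat_of_map n z ^\<^sub>m N = mat_of_map n (z ^^ N)"
      using mat_of_map_funpow[OF z zV] by simp
    also have "\<dots> = 0\<^sub>m n n"
      by (rule eq_matI) (auto simp: mat_of_map_def N unit)
    finally show ?thesis .
  qed
  moreover have "A = mat_of_map n e + mat_of_map n z"
    unfolding Af by (rule eq_matI) (auto simp: mat_of_map_def z_def)
  ultimately show ?thesis using mat_of_map_carrier by blast
qed

section \<open>The Jacobson radical of a matrix ring\<close>

text \<open>
If a left ideal above the column ideal contains some \<open>A\<close> with a nonzero entry in column \<open>j\<close>, then
multiplying by a matrix \<open>C\<close> with a single nonzero column gives \<open>C * A\<close> any desired \<open>j\<close>-th column.
Matrices with the same \<open>j\<close>-th column are congruent modulo the column ideal, so everything is reached.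
\<close>
lemma column_maximal_left_ideal:
  assumes j: "j < n"
  shows "maximal_left_ideal {A \<in> carrier_mat n n. \<forall>i<n. A $$ (i, j) = 0}
    (ring_mat TYPE('a::field) n ())"
    (is "maximal_left_ideal ?L ?R")
proof -
  interpret R: ring ?R by (rule ring_mat)
  have L: "left_ideal ?L ?R"
  proof (unfold_locales, goal_cases)
    case (4 x)
    have "\<ominus>\<^bsub>?R\<^esub> x = - x"
      using 4 by (intro R.minus_equality) (auto simp: ring_mat_def)
    then show ?case using 4 j by (auto simp: ring_mat_def a_inv_def)
  qed (use j in \<open>auto simp: ring_mat_def scalar_prod_def\<close>)
  interpret L: left_ideal ?L ?R by fact
  show ?thesis
  proof (unfold_locales)
    have "1\<^sub>m n \<notin> ?L" using j by auto
    then show "carrier ?R \<noteq> ?L" by (auto simp: ring_mat_def)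
  next
    fix I
    assume I: "left_ideal I ?R" and LI: "?L \<subseteq> I" and IR: "I \<subseteq> carrier ?R"
    interpret I: left_ideal I ?R by fact
    show "I = ?L \<or> I = carrier ?R"
    proof (rule disjCI)
      assume "I \<noteq> carrier ?R"
      show "I = ?L"
      proof (rule ccontr)
        assume "I \<noteq> ?L"
        then obtain A i where A: "A \<in> I" "i < n" "A $$ (i, j) \<noteq> 0"
          using LI IR by (auto simp: ring_mat_simps)
        have Ac: "A \<in> carrier_mat n n" using A IR by (auto simp: ring_mat_simps)
        have "B \<in> I" if B: "B \<in> carrier_mat n n" for B
        proof -
          define C where "C = mat n n (\<lambda>(r, s). if s = i then B $$ (r, j) / A $$ (i, j) else 0)"
          have C: "C \<in> carrier_mat n n" by (simp add: C_def)
          have "(C * A) $$ (r, j) = B $$ (r, j)" if "r < n" for r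
            using that j A Ac
            by (simp add: C_def scalar_prod_def if_distrib if_distribR cong: if_cong)
          then have "B - C * A \<in> ?L" using B C Ac j by auto
          then have 1: "B - C * A \<in> I" using LI by blast
          have "C * A \<in> I" using I.l_closed[OF A(1), of C] C by (simp add: ring_mat_simps)
          with 1 have "(B - C * A) + C * A \<in> I"
            using I.a_closed by (simp add: ring_mat_simps)
          moreover have "(B - C * A) + C * A = B" using B C Ac by auto
          ultimately show ?thesis by simp
        qed
        then have "I = carrier ?R" using IR by (auto simp: ring_mat_simps)
        with \<open>I \<noteq> carrier ?R\<close> show False ..
      qed
    qed
  qed
qed

lemma jacobson_radical_mat:
  "jacobson_radical (ring_mat TYPE('a::field) n ()) = {0\<^sub>m n n}"
proof
  show "jacobson_radical (ring_mat TYPE('a) n ()) \<subseteq> {0\<^sub>m n n}"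
  proof
    fix A :: "'a mat"
    assume A: "A \<in> jacobson_radical (ring_mat TYPE('a) n ())"
    then have Ac: "A \<in> carrier_mat n n" by (auto simp: jacobson_radical_def ring_mat_simps)
    have "A $$ (i, j) = 0" if "i < n" "j < n" for i j
      using A column_maximal_left_ideal[OF that(2), where 'a = 'a] that
      unfolding jacobson_radical_def by blast
    then show "A \<in> {0\<^sub>m n n}" using Ac by auto
  qed
next
  interpret R: ring "ring_mat TYPE('a) n ()" by (rule ring_mat)
  have "0\<^sub>m n n \<in> I" if "maximal_left_ideal I (ring_mat TYPE('a) n ())" for I
  proof -
    interpret maximal_left_ideal I "ring_mat TYPE('a) n ()" by fact
    show ?thesis using zero_closed by (simp add: ring_mat_simps)
  qed
  then show "{0\<^sub>m n n} \<subseteq> jacobson_radical (ring_mat TYPE('a) n ())"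
    by (auto simp: jacobson_radical_def ring_mat_simps)
qed

lemma sqrt_jacobson_radical_mat:
  "sqrt_jacobson_radical (ring_mat TYPE('a::field) n ()) =
     {Z \<in> carrier_mat n n. \<exists>k\<ge>1. Z ^\<^sub>m k = 0\<^sub>m n n}"
  unfolding sqrt_jacobson_radical_def jacobson_radical_mat
  by (auto simp: ring_mat_simps pow_mat_ring_pow[where b = "()"])

section \<open>Scalar matrices with a splitting\<close>

text \<open>
Multiplying \<open>c = E + Z\<close> by \<open>E\<close> shows that \<open>Z\<close> acts on \<open>E\<close> from the right as the scalar
\<open>c - 1\<close>, which is invertible unless \<open>c = 1\<close>. As \<open>Z\<close> is nilpotent, \<open>E\<close> then has to vanish, and
\<open>c = Z\<close> is nilpotent itself.
\<close>
lemma scalar_mat_nil_clean_imp: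
  fixes c :: "'a::field"
  assumes n: "n > 0" and E: "E \<in> carrier_mat n n" "E * E = E"
    and Z: "Z \<in> carrier_mat n n" "Z ^\<^sub>m k = 0\<^sub>m n n"
    and sum: "c \<cdot>\<^sub>m 1\<^sub>m n = E + Z"
  shows "c = 0 \<or> c = 1"
proof (cases "E = 0\<^sub>m n n")
  case True
  then have Zc: "Z = c \<cdot>\<^sub>m 1\<^sub>m n" using sum Z by simp
  have "Z ^\<^sub>m j = c ^ j \<cdot>\<^sub>m 1\<^sub>m n" for j
  proof (induction j)
    case (Suc j)
    have "Z ^\<^sub>m Suc j = (c ^ j \<cdot>\<^sub>m 1\<^sub>m n) * (c \<cdot>\<^sub>m 1\<^sub>m n)" using Suc Zc by simp
    also have "\<dots> = c \<cdot>\<^sub>m (c ^ j \<cdot>\<^sub>m 1\<^sub>m n)"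
      by (simp add: mult_smult_distrib[of _ n n _ n])
    also have "\<dots> = c ^ Suc j \<cdot>\<^sub>m 1\<^sub>m n"
      by (intro eq_matI) auto
    finally show ?case .
  qed (use Z in auto)
  then have "c ^ k \<cdot>\<^sub>m 1\<^sub>m n = 0\<^sub>m n n" using Z(2) by simp
  then have "(c ^ k \<cdot>\<^sub>m 1\<^sub>m n) $$ (0, 0) = 0\<^sub>m n n $$ (0, 0)" by simp
  then have "c ^ k = 0" using n by simp
  then show ?thesis by simp
next
  case False
  have "E * (E + Z) = c \<cdot>\<^sub>m E"
    unfolding sum[symmetric] using E by (simp add: mult_smult_distrib[of _ n n _ n])
  then have "E + E * Z = c \<cdot>\<^sub>m E"
    using E Z by (simp add: mult_add_distrib_mat[of _ n n])
  then have entry: "E $$ (i, j) + (E * Z) $$ (i, j) = c * E $$ (i, j)" if "i < n" "j < n" for i j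
    using that E Z by (metis carrier_matD index_add_mat(1) index_mult_mat(2,3) index_smult_mat(1))
  have EZ: "E * Z = (c - 1) \<cdot>\<^sub>m E"
  proof (rule eq_matI)
    fix i j
    assume "i < dim_row ((c - 1) \<cdot>\<^sub>m E)" "j < dim_col ((c - 1) \<cdot>\<^sub>m E)"
    then show "(E * Z) $$ (i, j) = ((c - 1) \<cdot>\<^sub>m E) $$ (i, j)"
      using entry[of i j] E Z by (simp add: algebra_simps)
  qed (use E Z in auto)
  have pow: "E * Z ^\<^sub>m j = (c - 1) ^ j \<cdot>\<^sub>m E" for j
  proof (induction j)
    case (Suc j)
    have "E * Z ^\<^sub>m Suc j = (E * Z ^\<^sub>m j) * Z"
      using E Z by (simp add: assoc_mult_mat[of _ n n _ n _ n])
    also have "\<dots> = (c - 1) ^ j \<cdot>\<^sub>m ((c - 1) \<cdot>\<^sub>m E)"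
      using E Z by (simp add: Suc EZ mult_smult_assoc_mat[of _ n n _ n])
    also have "\<dots> = (c - 1) ^ Suc j \<cdot>\<^sub>m E"
      by (intro eq_matI) auto
    finally show ?case .
  qed (use E Z in auto)
  have "(c - 1) ^ k \<cdot>\<^sub>m E = 0\<^sub>m n n"
    using pow[of k] E Z by simp
  then have all: "(c - 1) ^ k * E $$ (i, j) = 0" if "i < n" "j < n" for i j
    using that E by (metis carrier_matD index_smult_mat(1) index_zero_mat(1))
  obtain i j where "i < n" "j < n" "E $$ (i, j) \<noteq> 0"
    using False E by (metis carrier_matD eq_matI index_zero_mat)
  with all[of i j] show ?thesis by simp
qed

section \<open>The equivalence\<close>

lemma iso_bit_iff:
  "(class_ring :: 'a::field ring) \<simeq> (class_ring :: bit ring) \<longleftrightarrow> (\<forall>c::'a. c = 0 \<or> c = 1)"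
proof
  assume "(class_ring :: 'a::field ring) \<simeq> (class_ring :: bit ring)"
  then obtain h :: "'a \<Rightarrow> bit" where h: "h \<in> Ring.ring_hom class_ring class_ring" "bij h"
    by (auto simp: is_ring_iso_def ring_iso_def)
  have h1: "h 1 = 1" and add: "h (x + y) = h x + h y" for x y
    using h(1) by (auto simp: Ring.ring_hom_def)
  have h0: "h 0 = 0" using add[of 0 0] by simp
  show "\<forall>c::'a. c = 0 \<or> c = 1"
  proof
    fix c :: 'a
    have "h c = h 0 \<or> h c = h 1" using h0 h1 by (cases "h c") auto
    then show "c = 0 \<or> c = 1" using h(2) by (metis bij_is_inj injD)
  qed
next
  assume two: "\<forall>c::'a. c = 0 \<or> c = 1"
  have 11: "(1::'a) + 1 = 0" using two by (metis add_cancel_right_right zero_neq_one)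
  define h :: "'a \<Rightarrow> bit" where "h c = (if c = 0 then 0 else 1)" for c
  have "h (x * y) = h x * h y" "h (x + y) = h x + h y" for x y
    using spec[OF two, of x] spec[OF two, of y] 11 by (auto simp: h_def)
  then have "h \<in> Ring.ring_hom class_ring class_ring"
    by (auto simp: Ring.ring_hom_def h_def)
  moreover have "bij h"
  proof (rule bijI)
    show "inj h" using two by (auto simp: inj_def h_def split: if_splits)
    show "surj h"
    proof (rule surjI)
      show "h (if b = 0 then 0 else 1) = b" for b by (cases b) (auto simp: h_def)
    qed
  qed
  ultimately show "(class_ring :: 'a::field ring) \<simeq> (class_ring :: bit ring)"
    by (auto simp: is_ring_iso_def ring_iso_def)
qed

lemma two_element_field_mat_sqrtJ_clean:
  assumes two: "\<And>c::'a::field. c = 0 \<or> c = 1" and n: "n > 0"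
  shows "sqrtJ_clean_ring (ring_mat TYPE('a) n ())"
proof -
  interpret R: ring "ring_mat TYPE('a) n ()" by (rule ring_mat)
  show ?thesis
  proof
    have "(1\<^sub>m n :: 'a mat) $$ (0, 0) \<noteq> 0\<^sub>m n n $$ (0, 0)" using n by simp
    then show "\<one>\<^bsub>ring_mat TYPE('a) n ()\<^esub> \<noteq> \<zero>\<^bsub>ring_mat TYPE('a) n ()\<^esub>"
      by (auto simp: ring_mat_simps)
  next
    fix A assume "A \<in> carrier (ring_mat TYPE('a) n ())"
    then obtain E Z k where *: "E \<in> carrier_mat n n" "E * E = E" "Z \<in> carrier_mat n n"
      "Z ^\<^sub>m k = 0\<^sub>m n n" "A = E + Z"
      using two_element_field_mat_nil_clean[OF two] by (metis ring_mat_simps(5))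
    \<comment> \<open>Membership in the square root of the radical requires a positive exponent, and \<open>k\<close> may be 0.\<close>
    then have "Z ^\<^sub>m Suc k = 0\<^sub>m n n" by simp
    then have "Z \<in> sqrt_jacobson_radical (ring_mat TYPE('a) n ())"
      using * unfolding sqrt_jacobson_radical_mat by (auto intro!: exI[of _ "Suc k"])
    then show "\<exists>e z. e \<in> carrier (ring_mat TYPE('a) n ()) \<and>
        e \<otimes>\<^bsub>ring_mat TYPE('a) n ()\<^esub> e = e \<and> z \<in> sqrt_jacobson_radical (ring_mat TYPE('a) n ()) \<and>
        A = e \<oplus>\<^bsub>ring_mat TYPE('a) n ()\<^esub> z"
      using * by (auto simp: ring_mat_simps)
  qed
qed

lemma mat_sqrtJ_clean_two_elements:
  fixes c :: "'a::field"
  assumes "sqrtJ_clean_ring (ring_mat TYPE('a) n ())" and n: "n > 0"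
  shows "c = 0 \<or> c = 1"
proof -
  interpret sqrtJ_clean_ring "ring_mat TYPE('a) n ()" by fact
  obtain E Z where "E \<in> carrier_mat n n" "E * E = E" "c \<cdot>\<^sub>m 1\<^sub>m n = E + Z"
    "Z \<in> sqrt_jacobson_radical (ring_mat TYPE('a) n ())"
    using clean[of "c \<cdot>\<^sub>m 1\<^sub>m n"] by (auto simp: ring_mat_simps)
  then show ?thesis
    unfolding sqrt_jacobson_radical_mat using scalar_mat_nil_clean_imp[OF n] by blast
qed

theorem theorem5p4:
  shows "((class_ring :: 'a::field ring) \<simeq> (class_ring :: bit ring) \<longleftrightarrow>
            (\<forall>n::nat. n > 0 \<longrightarrow> sqrtJ_clean_ring (ring_mat TYPE('a) n ()))) \<and>
         ((\<forall>n::nat. n > 0 \<longrightarrow> sqrtJ_clean_ring (ring_mat TYPE('a) n ())) \<longleftrightarrow>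
            (\<exists>n::nat. n > 0 \<and> sqrtJ_clean_ring (ring_mat TYPE('a) n ())))"
proof -
  have "\<exists>n::nat. n > 0 \<and> sqrtJ_clean_ring (ring_mat TYPE('a) n ())"
    if "\<forall>n::nat. n > 0 \<longrightarrow> sqrtJ_clean_ring (ring_mat TYPE('a) n ())"
    using that by (intro exI[of _ 1]) simp
  moreover have "\<forall>c::'a. c = 0 \<or> c = 1"
    if "\<exists>n::nat. n > 0 \<and> sqrtJ_clean_ring (ring_mat TYPE('a) n ())"
    using that mat_sqrtJ_clean_two_elements by blast
  moreover have "\<forall>n::nat. n > 0 \<longrightarrow> sqrtJ_clean_ring (ring_mat TYPE('a) n ())"
    if "\<forall>c::'a. c = 0 \<or> c = 1"
    using that two_element_field_mat_sqrtJ_clean by blast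
  ultimately show ?thesis unfolding iso_bit_iff by blast
qed

end
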